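(* Let $G$ be a group with a $(1,C)$-acylindrical action (without edge inversions) on a simplicial tree $T$ (so the edge stabilizers are finite), and let $\{R_v\}_{v\in V(T)}$ be an equivariant family of subgroups of $G$. Then the quotient action of $G/\langle R_v\rangle$ on $T/\langle R_v\rangle$ remains $(1,C)$-acylindrical.
   Context: Equivariant family: for $G$ acting on a tree $T$, a family $\{R_v\}_{v\in V(T)}$, with each $R_v$ a subgroup of the stabilizer of $v$ in $G$, is an equivariant family of subgroups if $gR_vg^{-1}=R_{gv}$ for all $g\in G$ and $v\in V(T)$. $\langle R_v\rangle$ is the subgroup of $G$ generated by all the $R_v$, $v\in V(T)$; it is normal in $G$. An action of a group on a simplicial tree is $(k,C)$-acylindrical (integers $k\ge0$, $C>0$) if the pointwise stabilizer of any edge path of length at least $k$ contains at most $C$ elements. *)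

theory Defs
  imports
    "Graph_Theory.Digraph_Component"
    "Graph_Theory.Bidirected_Digraph"
    "Graph_Theory.Arc_Walk"
    "HOL-Algebra.Group_Action"
    "HOL-Algebra.Generated_Groups"
begin

text \<open>
  Graphs are taken in the sense of Serre: every geometric edge is a pair of distinct arcs
  exchanged by \<open>arev\<close>. This keeps loops and multiple edges visible, so a quotient
  graph is not made simple by its encoding.
\<close>

definition reduced :: "('e \<Rightarrow> 'e) \<Rightarrow> 'e list \<Rightarrow> bool" where
  "reduced arev p \<longleftrightarrow> successively (\<lambda>a b. b \<noteq> arev a) p"

text \<open>
  The library predicate \<open>tree\<close> forbids directed cycles, hence fails as soon as an arc
  and its reverse are both present. Here only cycles without backtracking are forbidden;
  these include loops and pairs of parallel edges.
\<close>

locale simplicial_tree = bidirected_digraph T arev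
  for T :: "('v, 'e) pre_digraph" and arev :: "'e \<Rightarrow> 'e" +
  assumes connected: "connected T"
    and no_circuit: "\<not> (\<exists>p. cycle p \<and> reduced arev p)"

text \<open>Compatibility with \<open>head\<close> follows from that with \<open>tail\<close> and \<open>arev\<close>.\<close>

locale tree_action =
  simplicial_tree T arev +
  vert: group_action G "verts T" \<phi> +
  arc: group_action G "arcs T" \<psi>
  for G :: "('g, 'm) monoid_scheme"
    and T :: "('v, 'e) pre_digraph" and arev :: "'e \<Rightarrow> 'e"
    and \<phi> :: "'g \<Rightarrow> 'v \<Rightarrow> 'v" and \<psi> :: "'g \<Rightarrow> 'e \<Rightarrow> 'e" +
  assumes tail_equivariant:
      "\<lbrakk>g \<in> carrier G; e \<in> arcs T\<rbrakk> \<Longrightarrow> tail T (\<psi> g e) = \<phi> g (tail T e)"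
    and arev_equivariant:
      "\<lbrakk>g \<in> carrier G; e \<in> arcs T\<rbrakk> \<Longrightarrow> \<psi> g (arev e) = arev (\<psi> g e)"
    and no_inversion:
      "\<lbrakk>g \<in> carrier G; e \<in> arcs T\<rbrakk> \<Longrightarrow> \<psi> g e \<noteq> arev e"

text \<open>
  An edge path is a walk without backtracking. Its initial vertex enters the pointwise
  stabilizer explicitly, which matters only for paths of length 0.
\<close>

locale acylindrical_tree_action = tree_action G T arev \<phi> \<psi>
  for k C :: nat
    and G :: "('g, 'm) monoid_scheme"
    and T :: "('v, 'e) pre_digraph" and arev :: "'e \<Rightarrow> 'e"
    and \<phi> :: "'g \<Rightarrow> 'v \<Rightarrow> 'v" and \<psi> :: "'g \<Rightarrow> 'e \<Rightarrow> 'e" +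
  assumes C_pos: "C > 0"
    and acylindrical:
      "\<lbrakk>awalk u p v; reduced arev p; length p \<ge> k;
        S = stabilizer G \<phi> u \<inter> (\<Inter>e\<in>set p. stabilizer G \<psi> e)\<rbrakk>
       \<Longrightarrow> finite S \<and> card S \<le> C"

definition equivariant_family ::
    "('g, 'm) monoid_scheme \<Rightarrow> 'v set \<Rightarrow> ('g \<Rightarrow> 'v \<Rightarrow> 'v) \<Rightarrow> ('v \<Rightarrow> 'g set) \<Rightarrow> bool" where
  "equivariant_family G V \<phi> R \<longleftrightarrow>
     (\<forall>v\<in>V. subgroup (R v) (G\<lparr>carrier := stabilizer G \<phi> v\<rparr>)) \<and>
     (\<forall>g\<in>carrier G. \<forall>v\<in>V. g <#\<^bsub>G\<^esub> R v #>\<^bsub>G\<^esub> inv\<^bsub>G\<^esub> g = R (\<phi> g v))"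

definition orbits_of ::
    "('g, 'm) monoid_scheme \<Rightarrow> 'g set \<Rightarrow> 'x set \<Rightarrow> ('g \<Rightarrow> 'x \<Rightarrow> 'x) \<Rightarrow> 'x set set" where
  "orbits_of G N X \<phi> = orbits (G\<lparr>carrier := N\<rparr>) X \<phi>"

text \<open>
  By equivariance the image under \<open>tail T\<close> of an \<open>N\<close>-orbit of arcs is exactly
  the \<open>N\<close>-orbit of the tail of any representative; likewise for \<open>head T\<close>
  and \<open>arev\<close>.
\<close>

definition quotient_graph ::
    "('g, 'm) monoid_scheme \<Rightarrow> 'g set \<Rightarrow> ('v, 'e) pre_digraph \<Rightarrow>
     ('g \<Rightarrow> 'v \<Rightarrow> 'v) \<Rightarrow> ('g \<Rightarrow> 'e \<Rightarrow> 'e) \<Rightarrow> ('v set, 'e set) pre_digraph" where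
  "quotient_graph G N T \<phi> \<psi> =
     \<lparr>verts = orbits_of G N (verts T) \<phi>,
      arcs = orbits_of G N (arcs T) \<psi>,
      tail = (\<lambda>A. tail T ` A),
      head = (\<lambda>A. head T ` A)\<rparr>"

text \<open>The locale \<open>bidirected_digraph\<close> wants reversal to be the identity off the arcs.\<close>

definition quotient_rev ::
    "('g, 'm) monoid_scheme \<Rightarrow> 'g set \<Rightarrow> ('v, 'e) pre_digraph \<Rightarrow>
     ('g \<Rightarrow> 'e \<Rightarrow> 'e) \<Rightarrow> ('e \<Rightarrow> 'e) \<Rightarrow> 'e set \<Rightarrow> 'e set" where
  "quotient_rev G N T \<psi> arev A = (if A \<in> orbits_of G N (arcs T) \<psi> then arev ` A else A)"

text \<open>
  For \<open>N\<close> normal this is the action \<open>(N g) \<cdot> (N x) = N (g x)\<close> of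
  \<open>G Mod N\<close> on the \<open>N\<close>-orbits; it is restricted because
  \<open>group_action\<close> requires extensional maps.
\<close>

definition quotient_action ::
    "('g, 'm) monoid_scheme \<Rightarrow> 'g set \<Rightarrow> 'x set \<Rightarrow> ('g \<Rightarrow> 'x \<Rightarrow> 'x) \<Rightarrow>
     'g set \<Rightarrow> 'x set \<Rightarrow> 'x set" where
  "quotient_action G N X \<phi> K = (\<lambda>A\<in>orbits_of G N X \<phi>. \<Union>g\<in>K. \<phi> g ` A)"

end

theory Submission
  imports Defs
begin

text \<open>
  The heart of the matter is that the quotient graph \<open>T / N\<close> has no reduced cycle. This
  holds because \<open>N\<close> is generated by elements that fix a vertex. If \<open>s\<close> fixes
  \<open>w\<close>, then a walk \<open>q\<close> from \<open>v\<close> to \<open>w\<close> followed by the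
  \<open>s\<close>-translate of its reverse leads from \<open>v\<close> to \<open>s v\<close>, and in
  \<open>T / N\<close> this walk is the image of \<open>q\<close> traversed back and forth, so it cancels
  completely. Concatenating such walks shows that for every \<open>n \<in> N\<close> some walk
  from \<open>v\<close> to \<open>n v\<close> has a null-homotopic image (\<open>generated_null_walk\<close>).

  Now let a reduced cycle in \<open>T / N\<close> be given. It lifts to a walk in \<open>T\<close> from
  some \<open>u\<close> to some \<open>n u\<close> with \<open>n \<in> N\<close>. Walks in a tree with the same
  ends are homotopic, and homotopies descend to the quotient
  (\<open>closed_walk_null_homotopic\<close>); comparison with the null-homotopic walk from
  \<open>u\<close> to \<open>n u\<close> shows that the cycle is null-homotopic. A reduced null-homotopic
  word is empty (\<open>null_homotopic_reduced_eq_Nil\<close>), a contradiction.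

  Acylindricity then follows from the identity of \<open>stabilizer_orb\<close>: if \<open>g\<close> maps
  \<open>e\<close> into its own \<open>N\<close>-orbit, then \<open>g\<close> can be corrected by an element
  of \<open>N\<close> so as to fix \<open>e\<close>. Hence the stabilizer in \<open>G Mod N\<close> of an orbit
  of arcs is the image of the stabilizer of an arc, which has at most \<open>C\<close> elements.
\<close>

section \<open>Free reduction of edge words\<close>

definition cancel_cons :: "('e \<Rightarrow> 'e) \<Rightarrow> 'e \<Rightarrow> 'e list \<Rightarrow> 'e list" where
  "cancel_cons arev a w = (if w \<noteq> [] \<and> hd w = arev a then tl w else a # w)"

text \<open>
  Left multiplication by a letter, followed by free reduction, lets words act on reduced words;
  a word represents the trivial element of the fundamental groupoid when it acts as the identity.
  Concatenation of words then is composition of maps, and a reduced word is recovered by acting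
  on the empty word, which takes the place of a confluence argument for cancellation.
\<close>

definition null_homotopic :: "('e \<Rightarrow> 'e) \<Rightarrow> 'e list \<Rightarrow> bool" where
  "null_homotopic arev p \<longleftrightarrow> (\<forall>w. reduced arev w \<longrightarrow> foldr (cancel_cons arev) p w = w)"

lemma reduced_Nil: "reduced arev []"
  by (simp add: reduced_def)

lemma reduced_appendD: "reduced arev (p @ q) \<Longrightarrow> reduced arev p \<and> reduced arev q"
  by (auto simp: reduced_def successively_append_iff)

lemma not_reducedE:
  assumes "\<not> reduced arev p"
  obtains q a r where "p = q @ a # arev a # r"
proof -
  have "\<exists>q a r. p = q @ a # arev a # r"
    using assms unfolding reduced_def
  proof (induction p rule: induct_list012)
    case (3 a b p)
    show ?case
    proof (cases "b = arev a")
      case True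
      then show ?thesis by (metis append_Nil)
    next
      case False
      with 3 obtain q c r where "b # p = q @ c # arev c # r" by auto
      then show ?thesis by (metis append_Cons)
    qed
  qed auto
  with that show thesis by blast
qed

lemma reduced_cancel_cons: "reduced arev w \<Longrightarrow> reduced arev (cancel_cons arev a w)"
  by (cases w) (auto simp: reduced_def cancel_cons_def successively_Cons)

lemma reduced_foldr_cancel_cons:
  "reduced arev w \<Longrightarrow> reduced arev (foldr (cancel_cons arev) p w)"
  by (induction p) (auto intro: reduced_cancel_cons)

text \<open>
  The cancellation law that makes the action of words invariant under homotopy. It needs
  \<open>w\<close> to be reduced: if \<open>w\<close> starts with \<open>a\<close>, which the inner step
  removes, its second letter must differ from \<open>arev a\<close> for the outer step to put
  \<open>a\<close> back.
\<close>

lemma cancel_cons_inverse: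
  assumes "\<And>a. arev (arev a) = a" "reduced arev w"
  shows "cancel_cons arev a (cancel_cons arev (arev a) w) = w"
  using assms(2) by (cases w) (auto simp: cancel_cons_def reduced_def successively_Cons assms(1))

lemma foldr_cancel_cons_reduced:
  "reduced arev p \<Longrightarrow> foldr (cancel_cons arev) p [] = p"
proof (induction p)
  case (Cons a p)
  then show ?case by (cases p) (auto simp: cancel_cons_def reduced_def)
qed simp

text \<open>
  Evaluate the action at the empty word: a reduced word sends it to itself, a null-homotopic
  one leaves it empty.
\<close>

lemma null_homotopic_reduced_eq_Nil:
  assumes "null_homotopic arev p" "reduced arev p"
  shows "p = []"
  using assms foldr_cancel_cons_reduced[of arev p] reduced_Nil[of arev]
  unfolding null_homotopic_def by metis

lemma null_homotopic_Nil: "null_homotopic arev []"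
  by (simp add: null_homotopic_def)

lemma null_homotopic_append:
  "null_homotopic arev p \<Longrightarrow> null_homotopic arev q \<Longrightarrow> null_homotopic arev (p @ q)"
  by (simp add: null_homotopic_def)

lemma null_homotopic_appendD1:
  "null_homotopic arev (p @ q) \<Longrightarrow> null_homotopic arev q \<Longrightarrow> null_homotopic arev p"
  by (simp add: null_homotopic_def)

lemma null_homotopic_insert:
  assumes "\<And>a. arev (arev a) = a" "null_homotopic arev (p @ q)"
  shows "null_homotopic arev (p @ a # arev a # q)"
  using assms(2)
  by (auto simp: null_homotopic_def cancel_cons_inverse[of arev, OF assms(1)] reduced_foldr_cancel_cons)

lemma null_homotopic_backtrack:
  assumes "\<And>a. arev (arev a) = a"
  shows "null_homotopic arev (p @ map arev (rev p))"
proof (induction p rule: rev_induct)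
  case (snoc a p)
  then show ?case
    using null_homotopic_insert[of arev p "map arev (rev p)" a] assms by simp
qed (simp add: null_homotopic_Nil)

lemma null_homotopic_inverse:
  assumes "\<And>a. arev (arev a) = a" "null_homotopic arev p"
  shows "null_homotopic arev (map arev (rev p))"
proof -
  have "map arev (rev p) @ map arev (rev (map arev (rev p))) = map arev (rev p) @ p"
    by (simp add: rev_map assms(1) comp_def)
  then show ?thesis
    using null_homotopic_backtrack[of arev "map arev (rev p)"] null_homotopic_appendD1 assms
    by metis
qed

section \<open>Walks in trees\<close>

lemma (in bidirected_digraph) awalk_reverse:
  "awalk u p v \<Longrightarrow> awalk v (map arev (rev p)) u"
proof (induction p arbitrary: u)
  case (Cons e p)
  then have "awalk v (map arev (rev p)) (head G e)" "e \<in> arcs G" "tail G e = u" "u \<in> verts G"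
    by (auto simp: awalk_Cons_iff)
  then show ?case by (auto simp: awalk_simps)
qed (simp add: awalk_simps)

context simplicial_tree
begin

text \<open>
  The tree axiom excludes reduced cycles only; a closed reduced walk with a repeated vertex
  contains a shorter one as a segment, and segments of reduced walks are reduced.
\<close>

lemma reduced_closed_walk_Nil:
  assumes "awalk u p u" "reduced arev p"
  shows "p = []"
  using assms
proof (induction "length p" arbitrary: u p rule: less_induct)
  case less
  show ?case
  proof (rule ccontr)
    assume "p \<noteq> []"
    then obtain e es where p: "p = e # es" by (cases p) auto
    have "\<not> cycle p" using no_circuit less.prems(2) by blast
    then have "\<not> distinct (tl (awalk_verts u p))"
      using less.prems(1) \<open>p \<noteq> []\<close> by (auto simp: cycle_def)
    then have *: "awalk (head T e) es u" "\<not> distinct (awalk_verts (head T e) es)"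
      using less.prems(1) by (auto simp: p awalk_Cons_iff)
    obtain q r s w where "es = q @ r @ s" "r \<noteq> []" "awalk w r w"
      using awalk_not_distinct_decomp[OF *] by auto
    moreover have "reduced arev r"
      using less.prems(2) reduced_appendD[of arev "e # q" "r @ s"] reduced_appendD[of arev r s]
      by (simp add: p \<open>es = q @ r @ s\<close>)
    moreover have "length r < length p" by (simp add: p \<open>es = q @ r @ s\<close>)
    ultimately show False using less.hyps by blast
  qed
qed

text \<open>
  Triviality of the fundamental group of a tree, stated for the image under any labelling
  \<open>f\<close> compatible with reversal, because cancellations in the tree are cancellations of
  labels while the converse fails. In the application \<open>f\<close> sends an arc to its orbit.
\<close>

lemma closed_walk_null_homotopic:
  assumes "awalk u p u"
    and inv: "\<And>a. r (r a) = a" and f: "\<And>e. e \<in> arcs T \<Longrightarrow> f (arev e) = r (f e)"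
  shows "null_homotopic r (map f p)"
  using assms(1)
proof (induction "length p" arbitrary: p rule: less_induct)
  case less
  show ?case
  proof (cases "reduced arev p")
    case True
    then show ?thesis
      using reduced_closed_walk_Nil[OF less.prems] by (simp add: null_homotopic_Nil)
  next
    case False
    then obtain q a s where p: "p = q @ a # arev a # s" by (rule not_reducedE)
    then have a: "a \<in> arcs T" using less.prems by (auto simp: awalk_Cons_iff)
    then have "awalk u (q @ s) u" using less.prems by (auto simp: p awalk_Cons_iff)
    then have "null_homotopic r (map f q @ map f s)" using less.hyps[of "q @ s"] by (simp add: p)
    then show ?thesis using null_homotopic_insert[of r "map f q" "map f s" "f a"] inv f[OF a] by (simp add: p)
  qed
qed

lemma walk_exists:
  assumes "u \<in> verts T" "v \<in> verts T"
  obtains p where "awalk u p v"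
proof -
  have "strongly_connected T"
    using symmetric_connected_imp_strongly_connected sym_arcs connected by blast
  then have "u \<rightarrow>\<^sup>*\<^bsub>T\<^esub> v" using assms by (simp add: strongly_connected_def)
  then show thesis using that by (auto simp: reachable_awalk)
qed

end

section \<open>Quotients of group actions\<close>

lemma group_actionI:
  assumes H: "group H"
    and closed: "\<And>h x. h \<in> carrier H \<Longrightarrow> x \<in> X \<Longrightarrow> f h x \<in> X"
    and ext: "\<And>h. h \<in> carrier H \<Longrightarrow> f h \<in> extensional X"
    and one: "\<And>x. x \<in> X \<Longrightarrow> f \<one>\<^bsub>H\<^esub> x = x"
    and mult: "\<And>g h x. g \<in> carrier H \<Longrightarrow> h \<in> carrier H \<Longrightarrow> x \<in> X \<Longrightarrow> f (g \<otimes>\<^bsub>H\<^esub> h) x = f g (f h x)"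
  shows "group_action H X f"
proof -
  interpret H: group H by (rule H)
  have Bij: "f h \<in> Bij X" if h: "h \<in> carrier H" for h
  proof -
    have "bij_betw (f h) X X"
    proof (rule bij_betw_byWitness[where f' = "f (inv\<^bsub>H\<^esub> h)"])
      show "\<forall>x\<in>X. f (inv\<^bsub>H\<^esub> h) (f h x) = x" "\<forall>x\<in>X. f h (f (inv\<^bsub>H\<^esub> h) x) = x"
        using h by (simp_all flip: mult add: one)
    qed (use h closed in auto)
    then show ?thesis using ext[OF h] by (simp add: Bij_def)
  qed
  have "f (g \<otimes>\<^bsub>H\<^esub> h) = compose X (f g) (f h)" if "g \<in> carrier H" "h \<in> carrier H" for g h
  proof (rule extensionalityI)
    show "f (g \<otimes>\<^bsub>H\<^esub> h) \<in> extensional X" using ext that by simp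
  qed (use that mult in \<open>auto simp: compose_eq\<close>)
  then have "f \<in> hom H (BijGroup X)"
    using Bij by (auto simp: hom_def BijGroup_def)
  then show ?thesis
    using H group_BijGroup by (simp add: group_action_def group_hom_def group_hom_axioms_def)
qed

locale normal_action = group_action G E \<phi> + normal N G
  for G (structure) and E and \<phi> and N
begin

abbreviation orb where "orb x \<equiv> orbit (G\<lparr>carrier := N\<rparr>) \<phi> x"

lemma action_closed: "g \<in> carrier G \<Longrightarrow> x \<in> E \<Longrightarrow> \<phi> g x \<in> E"
  by (rule element_image) auto

lemma action_one: "x \<in> E \<Longrightarrow> \<phi> \<one> x = x"
  by (metis id_eq_one restrict_apply')

lemma orb_eq: "orb x = (\<lambda>n. \<phi> n x) ` N"
  by (auto simp: orbit_def)

lemma orbits_of_eq: "orbits_of G N E \<phi> = orb ` E"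
  by (auto simp: orbits_of_def orbits_def)

lemma orb_refl: "x \<in> E \<Longrightarrow> x \<in> orb x"
  unfolding orb_eq by (rule image_eqI[where x = \<one>]) (simp_all add: action_one)

lemma orb_action:
  assumes "n \<in> N" "x \<in> E"
  shows "orb (\<phi> n x) = orb x"
proof
  show "orb (\<phi> n x) \<subseteq> orb x"
    using assms by (auto simp: orb_eq simp flip: composition_rule)
  have "\<phi> m x = \<phi> (m \<otimes> inv n) (\<phi> n x) \<and> m \<otimes> inv n \<in> N" if "m \<in> N" for m
    using assms that by (simp add: m_assoc flip: composition_rule)
  then show "orb x \<subseteq> orb (\<phi> n x)"
    unfolding orb_eq by blast
qed

lemma orb_eq_iff:
  assumes "x \<in> E" "y \<in> E"
  shows "orb x = orb y \<longleftrightarrow> (\<exists>n\<in>N. y = \<phi> n x)"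
proof
  assume "orb x = orb y"
  then have "y \<in> orb x" using orb_refl assms by simp
  then show "\<exists>n\<in>N. y = \<phi> n x" by (auto simp: orb_eq)
next
  assume "\<exists>n\<in>N. y = \<phi> n x"
  then obtain n where "n \<in> N" "y = \<phi> n x" by blast
  then show "orb x = orb y" using orb_action[of n x] assms(1) by (simp only:)
qed

text \<open>
  This computes the quotient action on representatives. Normality enters through
  \<open>g m = (g m g\<^sup>-\<^sup>1) g\<close>, which moves elements of \<open>N\<close> to the left of
  \<open>g\<close>.
\<close>

lemma quotient_action_orb:
  assumes g: "g \<in> carrier G" and x: "x \<in> E"
  shows "quotient_action G N E \<phi> (N #> g) (orb x) = orb (\<phi> g x)"
proof -
  have "(\<Union>h\<in>N #> g. \<phi> h ` orb x) = orb (\<phi> g x)"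
  proof (intro equalityI subsetI)
    fix y assume "y \<in> (\<Union>h\<in>N #> g. \<phi> h ` orb x)"
    then obtain n m where nm: "n \<in> N" "m \<in> N" and y: "y = \<phi> (n \<otimes> g) (\<phi> m x)"
      by (auto simp: r_coset_def orb_eq)
    have "n \<otimes> g \<otimes> m = (n \<otimes> (g \<otimes> m \<otimes> inv g)) \<otimes> g"
      using nm g by (simp add: m_assoc)
    moreover have "g \<otimes> m \<otimes> inv g \<in> N" using nm g by (simp add: inv_op_closed2)
    ultimately have "y = \<phi> (n \<otimes> (g \<otimes> m \<otimes> inv g)) (\<phi> g x)" "n \<otimes> (g \<otimes> m \<otimes> inv g) \<in> N"
      using nm g x by (simp_all add: y flip: composition_rule)
    then show "y \<in> orb (\<phi> g x)" by (auto simp: orb_eq)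
  next
    fix y assume "y \<in> orb (\<phi> g x)"
    then obtain n where "n \<in> N" "y = \<phi> (n \<otimes> g) x"
      using g x by (auto simp: orb_eq composition_rule)
    then show "y \<in> (\<Union>h\<in>N #> g. \<phi> h ` orb x)"
      using orb_refl[OF x] by (auto simp: r_coset_def)
  qed
  moreover have "orb x \<in> orbits_of G N E \<phi>" unfolding orbits_of_eq using x by (rule imageI)
  ultimately show ?thesis by (simp only: quotient_action_def restrict_apply if_True)
qed

lemma group_action_quotient:
  "group_action (G Mod N) (orbits_of G N E \<phi>) (quotient_action G N E \<phi>)"
proof (rule group_actionI)
  show "group (G Mod N)" by (rule factorgroup_is_group)
next
  fix K A assume "K \<in> carrier (G Mod N)" "A \<in> orbits_of G N E \<phi>"
  then obtain g x where "g \<in> carrier G" "K = N #> g" "x \<in> E" "A = orb x"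
    unfolding carrier_FactGroup orbits_of_eq by blast
  then show "quotient_action G N E \<phi> K A \<in> orbits_of G N E \<phi>"
    by (simp only: quotient_action_orb orbits_of_eq action_closed imageI)
next
  fix K show "quotient_action G N E \<phi> K \<in> extensional (orbits_of G N E \<phi>)"
    by (simp add: quotient_action_def)
next
  fix A assume "A \<in> orbits_of G N E \<phi>"
  then obtain x where "x \<in> E" "A = orb x"
    unfolding orbits_of_eq by blast
  then show "quotient_action G N E \<phi> \<one>\<^bsub>G Mod N\<^esub> A = A"
    using quotient_action_orb[of \<one> x] subset by (simp add: action_one)
next
  fix K L A assume "K \<in> carrier (G Mod N)" "L \<in> carrier (G Mod N)" "A \<in> orbits_of G N E \<phi>"
  then obtain g h x where "g \<in> carrier G" "K = N #> g" "h \<in> carrier G" "L = N #> h"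
      "x \<in> E" "A = orb x"
    unfolding carrier_FactGroup orbits_of_eq by blast
  then show "quotient_action G N E \<phi> (K \<otimes>\<^bsub>G Mod N\<^esub> L) A
      = quotient_action G N E \<phi> K (quotient_action G N E \<phi> L A)"
    by (simp add: quotient_action_orb action_closed rcos_sum composition_rule)
qed

text \<open>
  If \<open>g x = n x\<close> with \<open>n \<in> N\<close>, then \<open>n\<^sup>-\<^sup>1 g\<close> fixes
  \<open>x\<close> and represents the same coset as \<open>g\<close>. So passing to the quotient creates
  no new stabilizing elements.
\<close>

lemma stabilizer_orb:
  assumes x: "x \<in> E"
  shows "stabilizer (G Mod N) (quotient_action G N E \<phi>) (orb x) = (\<lambda>g. N #> g) ` stabilizer G \<phi> x"
proof (intro equalityI subsetI)
  fix K assume "K \<in> stabilizer (G Mod N) (quotient_action G N E \<phi>) (orb x)"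
  then obtain g where g: "g \<in> carrier G" "K = N #> g" and "orb x = orb (\<phi> g x)"
    using x by (auto simp: stabilizer_def carrier_FactGroup quotient_action_orb)
  then obtain n where n: "n \<in> N" "\<phi> g x = \<phi> n x"
    using x by (auto simp: orb_eq_iff action_closed)
  have "\<phi> (inv n \<otimes> g) x = x"
    using n g x by (simp add: composition_rule) (simp add: action_one flip: composition_rule)
  then have "inv n \<otimes> g \<in> stabilizer G \<phi> x" using n g by (simp add: stabilizer_def)
  moreover have "N #> (inv n \<otimes> g) = K"
    using n g subset by (simp add: coset_mult_assoc[symmetric] coset_join2 subgroup_axioms)
  ultimately show "K \<in> (\<lambda>g. N #> g) ` stabilizer G \<phi> x" by blast
next
  fix K assume "K \<in> (\<lambda>g. N #> g) ` stabilizer G \<phi> x"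
  then show "K \<in> stabilizer (G Mod N) (quotient_action G N E \<phi>) (orb x)"
    using x by (auto simp: stabilizer_def carrier_FactGroup quotient_action_orb)
qed

end

section \<open>The quotient of a tree by a normal subgroup\<close>

locale tree_quotient = tree_action G T arev \<phi> \<psi> + normal N G
  for G (structure) and T and arev and \<phi> and \<psi> and N
begin

sublocale vq: normal_action G "verts T" \<phi> N ..
sublocale aq: normal_action G "arcs T" \<psi> N ..

abbreviation Q where "Q \<equiv> quotient_graph G N T \<phi> \<psi>"
abbreviation qrev where "qrev \<equiv> quotient_rev G N T \<psi> arev"

lemma head_equivariant:
  "g \<in> carrier G \<Longrightarrow> e \<in> arcs T \<Longrightarrow> head T (\<psi> g e) = \<phi> g (head T e)"
  by (metis arev_equivariant arev_in_arcs aq.action_closed tail_arev tail_equivariant)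

lemma awalk_translate:
  "g \<in> carrier G \<Longrightarrow> awalk u p v \<Longrightarrow> awalk (\<phi> g u) (map (\<psi> g) p) (\<phi> g v)"
  by (induction p arbitrary: u)
    (auto simp: awalk_simps vq.action_closed aq.action_closed tail_equivariant head_equivariant)

lemma map_orb_translate:
  "n \<in> N \<Longrightarrow> set p \<subseteq> arcs T \<Longrightarrow> map aq.orb (map (\<psi> n) p) = map aq.orb p"
  by (auto simp: aq.orb_action)

lemma verts_Q: "verts Q = vq.orb ` verts T"
  by (simp add: quotient_graph_def vq.orbits_of_eq)

lemma arcs_Q: "arcs Q = aq.orb ` arcs T"
  by (simp add: quotient_graph_def aq.orbits_of_eq)

lemma tail_Q: "e \<in> arcs T \<Longrightarrow> tail Q (aq.orb e) = vq.orb (tail T e)"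
  by (simp add: quotient_graph_def aq.orb_eq vq.orb_eq tail_equivariant image_image)

lemma head_Q: "e \<in> arcs T \<Longrightarrow> head Q (aq.orb e) = vq.orb (head T e)"
  by (simp add: quotient_graph_def aq.orb_eq vq.orb_eq head_equivariant image_image)

lemma qrev_orb: "e \<in> arcs T \<Longrightarrow> qrev (aq.orb e) = aq.orb (arev e)"
  by (simp add: quotient_rev_def aq.orbits_of_eq aq.orb_eq arev_equivariant image_image)

lemma map_orb_reverse:
  assumes "awalk u p v"
  shows "map aq.orb (map arev (rev p)) = map qrev (rev (map aq.orb p))"
proof -
  have "set p \<subseteq> arcs T" using assms by blast
  then show ?thesis by (auto simp: rev_map qrev_orb)
qed

text \<open>
  An orbit of arcs fixed by reversal would contain an arc that some element of \<open>N\<close>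
  inverts.
\<close>

lemma bidirected_digraph_Q: "bidirected_digraph Q qrev"
proof -
  interpret Q: wf_digraph Q
    by unfold_locales (auto simp: verts_Q arcs_Q tail_Q head_Q)
  show ?thesis
  proof (rule Q.bidirected_digraphI)
    fix A assume "A \<notin> arcs Q"
    then show "qrev A = A" by (simp add: quotient_rev_def quotient_graph_def)
  next
    fix A assume "A \<in> arcs Q"
    then obtain e where e: "e \<in> arcs T" "A = aq.orb e" by (auto simp: arcs_Q)
    show "qrev A \<noteq> A"
    proof
      assume "qrev A = A"
      then have "aq.orb e = aq.orb (arev e)" using e by (simp add: qrev_orb)
      then obtain n where "n \<in> N" "arev e = \<psi> n e"
        using e aq.orb_eq_iff[of e "arev e"] by auto
      then show False using no_inversion[of n e] e by simp
    qed
    show "qrev (qrev A) = A" "tail Q (qrev A) = head Q A"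
      using e by (simp_all add: qrev_orb tail_Q head_Q)
  qed
qed

sublocale Q: bidirected_digraph Q qrev by (rule bidirected_digraph_Q)

lemma awalk_project: "awalk u p v \<Longrightarrow> Q.awalk (vq.orb u) (map aq.orb p) (vq.orb v)"
  by (induction p arbitrary: u) (auto simp: awalk_simps Q.awalk_simps verts_Q arcs_Q tail_Q head_Q)

text \<open>
  A lift can start at any prescribed vertex over the initial vertex: if the first arc is the
  orbit of \<open>e\<close>, an element of \<open>N\<close> translates \<open>e\<close> so that its tail is
  the prescribed vertex, and its head is where the rest of the lift starts.
\<close>

lemma awalk_lift:
  assumes "Q.awalk (vq.orb u) P W" "u \<in> verts T"
  shows "\<exists>p v. awalk u p v \<and> map aq.orb p = P \<and> vq.orb v = W"
  using assms
proof (induction P arbitrary: u)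
  case Nil
  then show ?case by (auto simp: Q.awalk_simps awalk_simps)
next
  case (Cons A P)
  then have A: "A \<in> arcs Q" "tail Q A = vq.orb u" "Q.awalk (head Q A) P W"
    by (auto simp: Q.awalk_simps)
  then obtain e where e: "e \<in> arcs T" "A = aq.orb e" by (auto simp: arcs_Q)
  with A Cons.prems obtain n where n: "n \<in> N" "u = \<phi> n (tail T e)"
    by (auto simp: tail_Q vq.orb_eq_iff)
  let ?e = "\<psi> n e"
  have e': "?e \<in> arcs T" "A = aq.orb ?e" "tail T ?e = u"
    using n e by (auto simp: aq.action_closed aq.orb_action tail_equivariant)
  then obtain p v where "awalk (head T ?e) p v" "map aq.orb p = P" "vq.orb v = W"
    using Cons.IH[of "head T ?e"] A(3) by (auto simp: head_Q)
  then have "awalk u (?e # p) v \<and> map aq.orb (?e # p) = A # P \<and> vq.orb v = W"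
    using e' by (auto simp: awalk_simps)
  then show ?case by (intro exI)
qed

lemma connected_Q: "connected Q"
proof (rule Q.connectedI)
  show "verts Q \<noteq> {}"
    using connected by (auto simp: verts_Q connected_def strongly_connected_def)
next
  fix A B assume "A \<in> verts Q" "B \<in> verts Q"
  then obtain u v where "u \<in> verts T" "A = vq.orb u" "v \<in> verts T" "B = vq.orb v"
    by (auto simp: verts_Q)
  then have "A \<rightarrow>\<^sup>*\<^bsub>Q\<^esub> B" by (metis walk_exists awalk_project Q.reachable_awalkI)
  then show "A \<rightarrow>\<^sup>*\<^bsub>mk_symmetric Q\<^esub> B" by (simp add: Q.reachable_mk_symmetric_eq Q.sym_arcs)
qed

text \<open>
  The walk runs from \<open>v\<close> to the fixed vertex \<open>w\<close> and returns along the
  \<open>n\<close>-translate; the quotient does not distinguish the translate from the original, so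
  the projected walk retraces its steps.
\<close>

lemma fixing_vertex_null_walk:
  assumes n: "n \<in> N" and w: "w \<in> verts T" "\<phi> n w = w" and v: "v \<in> verts T"
  shows "\<exists>p. awalk v p (\<phi> n v) \<and> null_homotopic qrev (map aq.orb p)"
proof -
  obtain q where q: "awalk v q w" using walk_exists v w by blast
  let ?q' = "map arev (rev q)"
  have q': "awalk w ?q' v" using q by (rule awalk_reverse)
  have "awalk w (map (\<psi> n) ?q') (\<phi> n v)"
    using awalk_translate[OF mem_carrier[OF n] q'] by (simp only: w(2))
  with q have "awalk v (q @ map (\<psi> n) ?q') (\<phi> n v)" by (rule awalk_appendI)
  moreover have "map aq.orb (q @ map (\<psi> n) ?q') = map aq.orb q @ map qrev (rev (map aq.orb q))"
  proof -
    have "set ?q' \<subseteq> arcs T" using q' by blast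
    then have "map aq.orb (map (\<psi> n) ?q') = map aq.orb ?q'" by (rule map_orb_translate[OF n])
    also have "\<dots> = map qrev (rev (map aq.orb q))" using q by (rule map_orb_reverse)
    finally show ?thesis by simp
  qed
  moreover have "null_homotopic qrev (map aq.orb q @ map qrev (rev (map aq.orb q)))"
    by (rule null_homotopic_backtrack) (rule Q.arev_arev)
  ultimately show ?thesis by (intro exI conjI) (assumption, simp only:)
qed

text \<open>
  For a product \<open>n m\<close>, the walk for \<open>n\<close> is continued by the
  \<open>n\<close>-translate of the walk for \<open>m\<close>, whose projection is unchanged by the
  translation.
\<close>

lemma generated_null_walk:
  assumes N: "N = generate G S"
    and S: "\<And>s. s \<in> S \<Longrightarrow> s \<in> carrier G \<and> (\<exists>w\<in>verts T. \<phi> s w = w)"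
    and n: "n \<in> N" and v: "v \<in> verts T"
  shows "\<exists>p. awalk v p (\<phi> n v) \<and> null_homotopic qrev (map aq.orb p)"
  using n[unfolded N] v
proof (induction n arbitrary: v rule: generate.induct)
  case one
  then show ?case
    by (intro exI[of _ "[]"]) (simp add: awalk_simps null_homotopic_Nil vq.action_one)
next
  case (incl s)
  have "s \<in> N" unfolding N using incl(1) by (rule generate.incl)
  then show ?case using fixing_vertex_null_walk S incl by blast
next
  case (inv s)
  obtain w where w: "w \<in> verts T" "\<phi> s w = w" using S inv by blast
  then have "\<phi> (inv s) w = w" using S inv vert.orbit_sym_aux by blast
  moreover have "inv s \<in> N" unfolding N using inv(1) by (rule generate.inv)
  ultimately show ?case using fixing_vertex_null_walk w inv by blast
next
  case (eng n m)
  then have nm: "n \<in> N" "m \<in> N" by (simp_all add: N)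
  obtain p where p: "awalk v p (\<phi> n v)" "null_homotopic qrev (map aq.orb p)"
    using eng by blast
  obtain q where q: "awalk v q (\<phi> m v)" "null_homotopic qrev (map aq.orb q)"
    using eng by blast
  have "awalk v (p @ map (\<psi> n) q) (\<phi> (n \<otimes> m) v)"
    using awalk_appendI[OF p(1) awalk_translate[OF mem_carrier[OF nm(1)] q(1)]] nm eng.prems
    by (simp add: vert.composition_rule)
  moreover have "null_homotopic qrev (map aq.orb (p @ map (\<psi> n) q))"
    using null_homotopic_append[OF p(2) q(2)] map_orb_translate[OF nm(1), of q] q(1)
    by (simp only: map_append awalk_def)
  ultimately show ?case by (intro exI conjI)
qed

text \<open>
  A reduced cycle lifts to a walk \<open>p\<close> from
  \<open>u\<close> to \<open>n u\<close>; the walk \<open>q\<close> of the preceding lemma closes it up,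
  and in the projection of the closed walk the contribution of \<open>q\<close> can be dropped.
\<close>

theorem simplicial_tree_Q:
  assumes N: "N = generate G S"
    and S: "\<And>s. s \<in> S \<Longrightarrow> s \<in> carrier G \<and> (\<exists>w\<in>verts T. \<phi> s w = w)"
  shows "simplicial_tree Q qrev"
proof unfold_locales
  show "connected Q" by (rule connected_Q)
  show "\<not> (\<exists>P. Q.cycle P \<and> reduced qrev P)"
  proof
    assume "\<exists>P. Q.cycle P \<and> reduced qrev P"
    then obtain P U where P: "Q.awalk U P U" "P \<noteq> []" "reduced qrev P"
      by (auto simp: Q.cycle_def)
    have "U \<in> verts Q" using P(1) by (rule Q.awalk_hd_in_verts)
    then obtain u where u: "u \<in> verts T" "U = vq.orb u" by (auto simp: verts_Q)
    obtain p v where p: "awalk u p v" "map aq.orb p = P" "vq.orb v = vq.orb u"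
      using awalk_lift[OF P(1)[unfolded u(2)] u(1)] by blast
    have v: "v \<in> verts T" using p(1) by (rule awalk_last_in_verts)
    obtain n where n: "n \<in> N" "v = \<phi> n u"
      using p(3)[symmetric] unfolding vq.orb_eq_iff[OF u(1) v] by blast
    obtain q where q: "awalk u q v" "null_homotopic qrev (map aq.orb q)"
      using generated_null_walk[OF N S n(1) u(1)] n by blast
    have "awalk u (p @ map arev (rev q)) u"
    using p(1) awalk_reverse[OF q(1)] by (rule awalk_appendI)
    then have "null_homotopic qrev (map aq.orb (p @ map arev (rev q)))"
      by (rule closed_walk_null_homotopic) (simp_all add: qrev_orb)
    moreover have "map aq.orb (map arev (rev q)) = map qrev (rev (map aq.orb q))"
      using q(1) by (rule map_orb_reverse)
    ultimately have "null_homotopic qrev (P @ map qrev (rev (map aq.orb q)))"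
      using p(2) by (simp del: map_map)
    then have "null_homotopic qrev P"
      using null_homotopic_appendD1 null_homotopic_inverse[OF Q.arev_arev q(2)] by blast
    then show False using null_homotopic_reduced_eq_Nil P by blast
  qed
qed

text \<open>
  The absence of inversions is inherited: if the coset of \<open>g\<close> inverted the orbit of
  \<open>e\<close>, then \<open>n g\<close> would invert \<open>e\<close> for some \<open>n \<in> N\<close>.
\<close>

lemma tree_action_Q:
  assumes "simplicial_tree Q qrev"
  shows "tree_action (G Mod N) Q qrev
    (quotient_action G N (verts T) \<phi>) (quotient_action G N (arcs T) \<psi>)"
proof -
  interpret tQ: simplicial_tree Q qrev by (rule assms)
  have va: "group_action (G Mod N) (verts Q) (quotient_action G N (verts T) \<phi>)"
    using vq.group_action_quotient by (simp add: quotient_graph_def)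
  have aa: "group_action (G Mod N) (arcs Q) (quotient_action G N (arcs T) \<psi>)"
    using aq.group_action_quotient by (simp add: quotient_graph_def)
  show ?thesis
  proof (intro tree_action.intro tree_action_axioms.intro assms va aa)
    fix K A assume "K \<in> carrier (G Mod N)" "A \<in> arcs Q"
    then obtain g e where g: "g \<in> carrier G" "K = N #> g" and e: "e \<in> arcs T" "A = aq.orb e"
      by (auto simp: carrier_FactGroup arcs_Q)
    note simps = g e aq.quotient_action_orb vq.quotient_action_orb tail_Q qrev_orb
      tail_equivariant arev_equivariant aq.action_closed
    show "tail Q (quotient_action G N (arcs T) \<psi> K A)
        = quotient_action G N (verts T) \<phi> K (tail Q A)"
      by (simp add: simps)
    show "quotient_action G N (arcs T) \<psi> K (qrev A) = qrev (quotient_action G N (arcs T) \<psi> K A)"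
      by (simp add: simps)
    show "quotient_action G N (arcs T) \<psi> K A \<noteq> qrev A"
    proof
      assume "quotient_action G N (arcs T) \<psi> K A = qrev A"
      then have "aq.orb (\<psi> g e) = aq.orb (arev e)" by (simp add: simps)
      then obtain n where n: "n \<in> N" "arev e = \<psi> n (\<psi> g e)"
        using g e by (auto simp: aq.orb_eq_iff aq.action_closed)
      then have "\<psi> (n \<otimes> g) e = arev e" using g e by (simp add: arc.composition_rule)
      then show False using no_inversion[of "n \<otimes> g" e] n g e by simp
    qed
  qed
qed

end

theorem theorem4p4:
  fixes G :: "('g, 'm) monoid_scheme"
    and T :: "('v, 'e) pre_digraph" and arev :: "'e \<Rightarrow> 'e"
    and \<phi> :: "'g \<Rightarrow> 'v \<Rightarrow> 'v" and \<psi> :: "'g \<Rightarrow> 'e \<Rightarrow> 'e"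
    and C :: nat and R :: "'v \<Rightarrow> 'g set" and N :: "'g set"
  assumes "acylindrical_tree_action 1 C G T arev \<phi> \<psi>"
    and "equivariant_family G (verts T) \<phi> R"
    and "N = generate G (\<Union>v\<in>verts T. R v)"
  shows "acylindrical_tree_action 1 C (G Mod N)
           (quotient_graph G N T \<phi> \<psi>) (quotient_rev G N T \<psi> arev)
           (quotient_action G N (verts T) \<phi>) (quotient_action G N (arcs T) \<psi>)"
proof -
  interpret acylindrical_tree_action 1 C G T arev \<phi> \<psi> by (rule assms(1))
  interpret group G using vert.group_hom by (rule group_hom.axioms(1))
  let ?S = "\<Union>v\<in>verts T. R v"
  have R_stab: "R v \<subseteq> stabilizer G \<phi> v" if "v \<in> verts T" for v
    using assms(2) that subgroup.subset by (fastforce simp: equivariant_family_def)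
  then have S: "s \<in> carrier G \<and> (\<exists>w\<in>verts T. \<phi> s w = w)" if "s \<in> ?S" for s
    using that by (fastforce simp: stabilizer_def)
  have "generate G ?S \<lhd> G"
  proof (rule normal_generateI)
    show "?S \<subseteq> carrier G" using S by blast
    fix s g assume s: "s \<in> ?S" and g: "g \<in> carrier G"
    then obtain v where v: "v \<in> verts T" "s \<in> R v" by blast
    have "g \<otimes>\<^bsub>G\<^esub> s \<otimes>\<^bsub>G\<^esub> inv\<^bsub>G\<^esub> g \<in> g <#\<^bsub>G\<^esub> R v #>\<^bsub>G\<^esub> inv\<^bsub>G\<^esub> g"
      using v by (auto simp: l_coset_def r_coset_def)
    also have "\<dots> = R (\<phi> g v)" using assms(2) g v by (simp add: equivariant_family_def)
    finally show "g \<otimes>\<^bsub>G\<^esub> s \<otimes>\<^bsub>G\<^esub> inv\<^bsub>G\<^esub> g \<in> ?S"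
      using vert.element_image g v by blast
  qed
  then have "N \<lhd> G" by (simp add: assms(3))
  then interpret tree_quotient G T arev \<phi> \<psi> N
    by (intro tree_quotient.intro tree_action_axioms)
  show ?thesis
  proof (intro acylindrical_tree_action.intro acylindrical_tree_action_axioms.intro)
    show "tree_action (G Mod N) Q qrev
        (quotient_action G N (verts T) \<phi>) (quotient_action G N (arcs T) \<psi>)"
      using simplicial_tree_Q[OF assms(3) S] by (rule tree_action_Q)
    show "C > 0" by (rule C_pos)
  next
    (* A walk of length at least 1 contains an arc, and the stabilizer of that arc alone
       is small enough. *)
    fix U P V S
    assume P: "Q.awalk U P V" "1 \<le> length P"
      and S: "S = stabilizer (G Mod N) (quotient_action G N (verts T) \<phi>) U
          \<inter> (\<Inter>A\<in>set P. stabilizer (G Mod N) (quotient_action G N (arcs T) \<psi>) A)"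
    then obtain A where A: "A \<in> set P" "A \<in> arcs Q" by (cases P) (auto simp: Q.awalk_simps)
    then obtain e where e: "e \<in> arcs T" "A = aq.orb e" by (auto simp: arcs_Q)
    (* An element fixing e fixes its tail, so the stabilizer of the one-arc walk [e] is
       the stabilizer of e. *)
    have "stabilizer G \<psi> e \<subseteq> stabilizer G \<phi> (tail T e)"
      using e tail_equivariant by (force simp: stabilizer_def)
    then have fin: "finite (stabilizer G \<psi> e) \<and> card (stabilizer G \<psi> e) \<le> C"
      using e acylindrical[of "tail T e" "[e]" "head T e" "stabilizer G \<psi> e"]
      by (auto simp: awalk_simps reduced_def)
    have "S \<subseteq> stabilizer (G Mod N) (quotient_action G N (arcs T) \<psi>) A" using S A by blast
    also have "\<dots> = (\<lambda>g. N #>\<^bsub>G\<^esub> g) ` stabilizer G \<psi> e"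
      using e by (simp add: aq.stabilizer_orb)
    finally have "S \<subseteq> (\<lambda>g. N #>\<^bsub>G\<^esub> g) ` stabilizer G \<psi> e" .
    then show "finite S \<and> card S \<le> C"
      using fin by (meson card_image_le card_mono finite_imageI finite_subset order_trans)
  qed
qed

end
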